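(* Let $\prec$ be an orderly ranking, $L$ an involutive division, and $F$ an $L$-involutive finite set of linear differential polynomials in $y_1,\dots,y_m$ over a differential field with $n$ derivations. For $1\le j\le m$ let $U_j$ be the monomial set associated with $ld_j(F)$, and for $u\in U_j$ let $\mu(u)$ be the number of $L$-multiplicative variables for $u$ (as an element of $U_j$). Then the Hilbert function of $[F]$ is, for all $s\in\mathbb{N}$, $$HF_{[F]}(s)=m\binom{n+s}{s}-\sum_{j=1}^m\sum_{i=0}^s\sum_{u\in U_j}\binom{i-\deg(u)+\mu(u)-1}{\mu(u)-1},$$ and the Hilbert polynomial of $[F]$ is $$HP_{[F]}(s)=m\binom{n+s}{s}-\sum_{j=1}^m\sum_{u\in U_j}\binom{s-\deg(u)+\mu(u)}{\mu(u)} .$$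
   Context: **Differential setting.** $\mathbb{K}$ is a differential field of characteristic zero with commuting derivations $\partial_1,\dots,\partial_n$, $\partial_i=\partial/\partial x_i$, and $\mathbb{K}\{y_1,\dots,y_m\}$ is the differential polynomial ring. A derivative is $\partial_\alpha y_j=\partial_1^{\alpha_1}\cdots\partial_n^{\alpha_n}y_j$, $\alpha\in\mathbb{N}^n$, of order $\alpha_1+\dots+\alpha_n$. A linear differential polynomial is a finite $\mathbb{K}$-linear combination of derivatives plus an element of $\mathbb{K}$. A ranking is a total order $\prec$ on derivatives with $\partial_i\partial_\alpha y_j\succ\partial_\alpha y_j$ and $\partial_\alpha y_j\succ\partial_\beta y_k\iff\partial_\gamma\partial_\alpha y_j\succ\partial_\gamma\partial_\beta y_k$. It is orderly if a derivative of larger order is always higher. $ld(f)$ is the highest derivative in $f$ and $lc(f)$ its coefficient (elements of $F$ are assumed to contain at least one derivative). $ld_j(F)$ is the set of leading derivatives of elements of $F$ that are derivatives of $y_j$. $[F]$ is the differential ideal generated by $F$. **Monomials.** $X=\{x_1,\dots,x_n\}$; $\mathbb{M}$ is the monoid of monomials $x^\alpha$, $\alpha\in\mathbb{N}^n$, and $\deg$ is total degree. The derivative $\partial_\alpha y_j$ is associated with $x^\alpha$, separately for each $j$. $U_j\subset\mathbb{M}$ is the monomial set associated with $ld_j(F)$. **Involutive division.** An involutive division $L$ on $\mathbb{M}$ assigns to each finite $U\subset\mathbb{M}$ and $u\in U$ a submonoid $L(u,U)\subseteq\mathbb{M}$ such that: (a) if $w\in L(u,U)$ and $v\mid w$, then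 $v\in L(u,U)$; (b) if $u,v\in U$ and $uL(u,U)\cap vL(v,U)\ne\emptyset$, then $u\in vL(v,U)$ or $v\in uL(u,U)$; (c) if $v\in U$ and $v\in uL(u,U)$, then $L(v,U)\subseteq L(u,U)$; (d) if $V\subseteq U$, then $L(u,U)\subseteq L(u,V)$ for all $u\in V$. The $L$-multiplicative variables for $u\in U$ are the variables $x_i\in L(u,U)$. **Involutive sets.** For $f\in F$ with $ld(f)=\partial_\alpha y_j$, a derivative $\theta=\partial_\beta y_j$ is a multiplicative prolongation of $ld(f)$ if $x^\beta\in x^\alpha L(x^\alpha,U_j)$. A linear $p$ is $L$-reducible modulo $f\in F$ if it has a term $a\theta$, $a\in\mathbb{K}\setminus\{0\}$, with $\theta$ a multiplicative prolongation of $ld(f)$; writing $\theta=\partial_\beta ld(f)$, the reduction replaces $p$ by $p-(a/lc(f))\partial_\beta f$. $NF_L(p,F)$ is the result of performing such reductions modulo elements of $F$ until none is possible. $F$ is $L$-autoreduced if no $f\in F$ is $L$-reducible modulo another element $g\in F$. $F$ is $L$-involutive if it is $L$-autoreduced and $NF_L(\partial_\alpha f,F)=0$ for all $f\in F$, $\alpha\in\mathbb{N}^n$. **Hilbert function and polynomial.** Principal derivatives are those of the form $\partial_\alpha\theta$ with $\theta\in ld(F)$, $\alpha\in\mathbb{N}^n$; all other derivatives are parametric. $HF_{[F]}(s)$ is the number of parametric derivatives of order $\le s$, and $HP_{[F]}$ is the polynomial in $s$ that agrees with $HF_{[F]}(s)$ for all sufficiently large $s$. **Binomial conventions.** In the formula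 for $HF_{[F]}$, the binomial coefficient counts the elements of degree $i$ in $uL(u,U_j)$: it is $0$ when $i<\deg(u)$, and when $\mu(u)=0$ it is $1$ if $i=\deg(u)$ and $0$ otherwise. In the formula for $HP_{[F]}$, the binomial coefficients are polynomials in $s$: $\binom{n+s}{s}=\binom{n+s}{n}$ and $\binom{s-\deg(u)+\mu(u)}{\mu(u)}=\frac{1}{\mu(u)!}\prod_{k=1}^{\mu(u)}(s-\deg(u)+k)$. *)

theory Defs
  imports
    "HOL-Library.Cardinality"
    "HOL-Library.Multiset"
    "HOL-Library.Poly_Mapping"
    "HOL-Library.Product_Plus"
    "HOL-Computational_Algebra.Polynomial"
begin

text \<open>The finite type \<open>'n\<close> indexes the derivations (and the variables \<open>x\<^sub>i\<close>), the finite type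
  \<open>'m\<close> indexes the differential indeterminates \<open>y\<^sub>j\<close>.

  Monomials are written additively, as elements of the free commutative monoid of multisets over
  \<open>'n\<close>: the multiplicity of \<open>i\<close> is the exponent of \<open>x\<^sub>i\<close>, \<^term>\<open>(+)\<close> is the product, \<^term>\<open>{#}\<close>
  is \<open>1\<close>, \<^term>\<open>{#i#}\<close> is \<open>x\<^sub>i\<close>, \<^term>\<open>(\<subseteq>#)\<close> is divisibility and \<^term>\<open>size\<close> is the total degree.\<close>

type_synonym 'n monom = "'n multiset"

text \<open>The pair \<open>(j, \<alpha>)\<close> is the derivative \<open>\<partial>\<^sub>\<alpha> y\<^sub>j\<close>. A linear differential polynomial is a finite
  linear combination of derivatives together with its constant term.\<close>

type_synonym ('n, 'm) deriv = "'m \<times> 'n monom"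

type_synonym ('n, 'm, 'k) lin_dpoly = "(('n, 'm) deriv \<Rightarrow>\<^sub>0 'k) \<times> 'k"


section \<open>Differential fields and linear differential polynomials\<close>

locale differential_field =
  fixes D :: "'n::finite \<Rightarrow> 'k::field_char_0 \<Rightarrow> 'k"
  assumes D_add: "D i (a + b) = D i a + D i b"
    and D_mult: "D i (a * b) = D i a * b + a * D i b"
    and D_commute: "D i (D j a) = D j (D i a)"

definition dprolong :: "'n monom \<Rightarrow> ('n, 'm) deriv \<Rightarrow> ('n, 'm) deriv"
  where "dprolong \<gamma> \<theta> = (fst \<theta>, \<gamma> + snd \<theta>)"

definition dorder :: "('n, 'm) deriv \<Rightarrow> nat"
  where "dorder \<theta> = size (snd \<theta>)"

definition ldp_scale :: "'k \<Rightarrow> ('n, 'm, 'k::field_char_0) lin_dpoly \<Rightarrow> ('n, 'm, 'k) lin_dpoly"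
  where "ldp_scale c p = (Poly_Mapping.map ((*) c) (fst p), c * snd p)"

definition ldp_diff ::
    "('n \<Rightarrow> 'k \<Rightarrow> 'k) \<Rightarrow> 'n \<Rightarrow> ('n, 'm, 'k::field_char_0) lin_dpoly \<Rightarrow> ('n, 'm, 'k) lin_dpoly"
  where "ldp_diff D i p =
    (\<Sum>\<theta>\<in>Poly_Mapping.keys (fst p).
        Poly_Mapping.single \<theta> (D i (Poly_Mapping.lookup (fst p) \<theta>))
        + Poly_Mapping.single (dprolong {#i#} \<theta>) (Poly_Mapping.lookup (fst p) \<theta>),
     D i (snd p))"

text \<open>The iterated derivation \<open>\<partial>\<^sub>\<alpha>\<close>; the fold does not depend on the order of application
  because the derivations of a differential field commute.\<close>

definition ldp_prolong ::
    "('n \<Rightarrow> 'k \<Rightarrow> 'k) \<Rightarrow> 'n monom \<Rightarrow> ('n, 'm, 'k::field_char_0) lin_dpoly \<Rightarrow> ('n, 'm, 'k) lin_dpoly"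
  where "ldp_prolong D \<alpha> p = fold_mset (ldp_diff D) p \<alpha>"


section \<open>Rankings and leading derivatives\<close>

locale ranking =
  fixes prec :: "('n::finite, 'm::finite) deriv \<Rightarrow> ('n, 'm) deriv \<Rightarrow> bool"
  assumes prec_irrefl: "\<not> prec \<theta> \<theta>"
    and prec_trans: "prec \<theta> \<eta> \<Longrightarrow> prec \<eta> \<zeta> \<Longrightarrow> prec \<theta> \<zeta>"
    and prec_total: "\<theta> \<noteq> \<eta> \<Longrightarrow> prec \<theta> \<eta> \<or> prec \<eta> \<theta>"
    and prec_diff: "prec \<theta> (dprolong {#i#} \<theta>)"
    and prec_prolong: "prec \<theta> \<eta> \<longleftrightarrow> prec (dprolong \<gamma> \<theta>) (dprolong \<gamma> \<eta>)"

locale orderly_ranking = ranking prec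
  for prec :: "('n::finite, 'm::finite) deriv \<Rightarrow> ('n, 'm) deriv \<Rightarrow> bool" +
  assumes prec_orderly: "dorder \<theta> < dorder \<eta> \<Longrightarrow> prec \<theta> \<eta>"

text \<open>Leading derivatives and coefficients are only meaningful for polynomials that contain a
  derivative, that is, \<open>fst f \<noteq> 0\<close>.\<close>

definition ld ::
    "(('n, 'm) deriv \<Rightarrow> ('n, 'm) deriv \<Rightarrow> bool) \<Rightarrow> ('n, 'm, 'k::zero) lin_dpoly \<Rightarrow> ('n, 'm) deriv"
  where "ld prec f = (THE \<theta>. \<theta> \<in> Poly_Mapping.keys (fst f) \<and>
    (\<forall>\<eta>\<in>Poly_Mapping.keys (fst f). \<eta> \<noteq> \<theta> \<longrightarrow> prec \<eta> \<theta>))"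

definition lc ::
    "(('n, 'm) deriv \<Rightarrow> ('n, 'm) deriv \<Rightarrow> bool) \<Rightarrow> ('n, 'm, 'k::zero) lin_dpoly \<Rightarrow> 'k"
  where "lc prec f = Poly_Mapping.lookup (fst f) (ld prec f)"

definition ld_monoms ::
    "(('n, 'm) deriv \<Rightarrow> ('n, 'm) deriv \<Rightarrow> bool) \<Rightarrow> ('n, 'm, 'k::zero) lin_dpoly set \<Rightarrow>
      'm \<Rightarrow> 'n monom set"
  where "ld_monoms prec F j = {\<alpha>. (j, \<alpha>) \<in> ld prec ` F}"


section \<open>Involutive divisions\<close>

definition inv_cone :: "('n monom \<Rightarrow> 'n monom set \<Rightarrow> 'n monom set) \<Rightarrow>
    'n monom \<Rightarrow> 'n monom set \<Rightarrow> 'n monom set"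
  where "inv_cone L u U = (\<lambda>w. u + w) ` L u U"

locale involutive_division =
  fixes L :: "'n::finite monom \<Rightarrow> 'n monom set \<Rightarrow> 'n monom set"
  assumes L_one: "finite U \<Longrightarrow> u \<in> U \<Longrightarrow> {#} \<in> L u U"
    and L_mult: "finite U \<Longrightarrow> u \<in> U \<Longrightarrow> v \<in> L u U \<Longrightarrow> w \<in> L u U \<Longrightarrow> v + w \<in> L u U"
    and L_dvd: "finite U \<Longrightarrow> u \<in> U \<Longrightarrow> w \<in> L u U \<Longrightarrow> v \<subseteq># w \<Longrightarrow> v \<in> L u U"
    and L_disjoint: "finite U \<Longrightarrow> u \<in> U \<Longrightarrow> v \<in> U \<Longrightarrow> inv_cone L u U \<inter> inv_cone L v U \<noteq> {} \<Longrightarrow>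
          u \<in> inv_cone L v U \<or> v \<in> inv_cone L u U"
    and L_nested: "finite U \<Longrightarrow> u \<in> U \<Longrightarrow> v \<in> U \<Longrightarrow> v \<in> inv_cone L u U \<Longrightarrow> L v U \<subseteq> L u U"
    and L_antimono: "finite U \<Longrightarrow> V \<subseteq> U \<Longrightarrow> u \<in> V \<Longrightarrow> L u U \<subseteq> L u V"

definition num_mult_vars ::
    "('n::finite monom \<Rightarrow> 'n monom set \<Rightarrow> 'n monom set) \<Rightarrow> 'n monom \<Rightarrow> 'n monom set \<Rightarrow> nat"
  where "num_mult_vars L u U = card {i. {#i#} \<in> L u U}"


section \<open>Involutive reduction and involutive sets\<close>

text \<open>Reductions of \<open>p\<close> modulo a single \<open>f \<in> F\<close>. The set \<open>F\<close> is a separate argument because the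
  multiplicative prolongations of \<open>ld f\<close> depend on it.\<close>

definition mult_prolongation ::
    "(('n, 'm) deriv \<Rightarrow> ('n, 'm) deriv \<Rightarrow> bool) \<Rightarrow>
     ('n monom \<Rightarrow> 'n monom set \<Rightarrow> 'n monom set) \<Rightarrow> ('n, 'm, 'k::zero) lin_dpoly set \<Rightarrow>
     ('n, 'm, 'k) lin_dpoly \<Rightarrow> ('n, 'm) deriv \<Rightarrow> bool"
  where "mult_prolongation prec L F f \<theta> \<longleftrightarrow>
     fst \<theta> = fst (ld prec f) \<and>
     snd \<theta> \<in> inv_cone L (snd (ld prec f)) (ld_monoms prec F (fst (ld prec f)))"

definition inv_reducible ::
    "(('n, 'm) deriv \<Rightarrow> ('n, 'm) deriv \<Rightarrow> bool) \<Rightarrow>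
     ('n monom \<Rightarrow> 'n monom set \<Rightarrow> 'n monom set) \<Rightarrow> ('n, 'm, 'k::zero) lin_dpoly set \<Rightarrow>
     ('n, 'm, 'k) lin_dpoly \<Rightarrow> ('n, 'm, 'k) lin_dpoly \<Rightarrow> bool"
  where "inv_reducible prec L F p f \<longleftrightarrow>
     (\<exists>\<theta>\<in>Poly_Mapping.keys (fst p). mult_prolongation prec L F f \<theta>)"

definition inv_reduces ::
    "('n \<Rightarrow> 'k \<Rightarrow> 'k) \<Rightarrow> (('n, 'm) deriv \<Rightarrow> ('n, 'm) deriv \<Rightarrow> bool) \<Rightarrow>
     ('n monom \<Rightarrow> 'n monom set \<Rightarrow> 'n monom set) \<Rightarrow> ('n, 'm, 'k::field_char_0) lin_dpoly set \<Rightarrow>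
     ('n, 'm, 'k) lin_dpoly \<Rightarrow> ('n, 'm, 'k) lin_dpoly \<Rightarrow> bool"
  where "inv_reduces D prec L F p q \<longleftrightarrow>
     (\<exists>f\<in>F. \<exists>\<beta>. let \<theta> = dprolong \<beta> (ld prec f); a = Poly_Mapping.lookup (fst p) \<theta> in
        a \<noteq> 0 \<and> mult_prolongation prec L F f \<theta> \<and>
        q = p - ldp_scale (a / lc prec f) (ldp_prolong D \<beta> f))"

text \<open>All possible results of reducing \<open>p\<close> as long as possible. That the normal form of \<open>p\<close> is
  \<open>h\<close> is expressed as \<open>inv_normal_forms D prec L F p = {h}\<close>.\<close>

definition inv_normal_forms ::
    "('n \<Rightarrow> 'k \<Rightarrow> 'k) \<Rightarrow> (('n, 'm) deriv \<Rightarrow> ('n, 'm) deriv \<Rightarrow> bool) \<Rightarrow>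
     ('n monom \<Rightarrow> 'n monom set \<Rightarrow> 'n monom set) \<Rightarrow> ('n, 'm, 'k::field_char_0) lin_dpoly set \<Rightarrow>
     ('n, 'm, 'k) lin_dpoly \<Rightarrow> ('n, 'm, 'k) lin_dpoly set"
  where "inv_normal_forms D prec L F p =
     {h. (inv_reduces D prec L F)\<^sup>*\<^sup>* p h \<and> \<not> (\<exists>f\<in>F. inv_reducible prec L F h f)}"

definition inv_autoreduced ::
    "(('n, 'm) deriv \<Rightarrow> ('n, 'm) deriv \<Rightarrow> bool) \<Rightarrow>
     ('n monom \<Rightarrow> 'n monom set \<Rightarrow> 'n monom set) \<Rightarrow> ('n, 'm, 'k::zero) lin_dpoly set \<Rightarrow>
     bool"
  where "inv_autoreduced prec L F \<longleftrightarrow>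
     (\<forall>f\<in>F. \<forall>g\<in>F. g \<noteq> f \<longrightarrow> \<not> inv_reducible prec L F f g)"

definition inv_set ::
    "('n::finite \<Rightarrow> 'k \<Rightarrow> 'k) \<Rightarrow> (('n, 'm::finite) deriv \<Rightarrow> ('n, 'm) deriv \<Rightarrow> bool) \<Rightarrow>
     ('n monom \<Rightarrow> 'n monom set \<Rightarrow> 'n monom set) \<Rightarrow>
     ('n, 'm, 'k::field_char_0) lin_dpoly set \<Rightarrow> bool"
  where "inv_set D prec L F \<longleftrightarrow>
     inv_autoreduced prec L F \<and>
     (\<forall>f\<in>F. \<forall>\<alpha>. inv_normal_forms D prec L F (ldp_prolong D \<alpha> f) = {0})"


section \<open>Hilbert function and Hilbert polynomial\<close>

text \<open>The Hilbert function of the differential ideal \<open>[F]\<close> is read off from the generators: it counts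
  the parametric derivatives, i.e. those that are not a derivative of a leading derivative of \<open>F\<close>.\<close>

definition principal_derivs ::
    "(('n, 'm) deriv \<Rightarrow> ('n, 'm) deriv \<Rightarrow> bool) \<Rightarrow> ('n, 'm, 'k::zero) lin_dpoly set \<Rightarrow>
      ('n, 'm) deriv set"
  where "principal_derivs prec F = {dprolong \<alpha> \<theta> | \<alpha> \<theta>. \<theta> \<in> ld prec ` F}"

definition hilbert_function ::
    "(('n::finite, 'm::finite) deriv \<Rightarrow> ('n, 'm) deriv \<Rightarrow> bool) \<Rightarrow>
     ('n, 'm, 'k::zero) lin_dpoly set \<Rightarrow> nat \<Rightarrow> nat"
  where "hilbert_function prec F s = card {\<theta>. \<theta> \<notin> principal_derivs prec F \<and> dorder \<theta> \<le> s}"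

definition eventually_polynomial :: "(nat \<Rightarrow> nat) \<Rightarrow> rat poly \<Rightarrow> bool"
  where "eventually_polynomial h p \<longleftrightarrow>
    (\<forall>\<^sub>F s in sequentially. poly p (of_nat s) = of_nat (h s))"

lemma eventually_polynomial_unique:
  assumes "eventually_polynomial h p" "eventually_polynomial h q"
  shows "p = q"
proof -
  have "\<forall>\<^sub>F s in sequentially. poly (p - q) (of_nat s) = 0"
    using assms unfolding eventually_polynomial_def by eventually_elim simp
  then obtain N where N: "\<And>s. s \<ge> N \<Longrightarrow> poly (p - q) (of_nat s) = 0"
    unfolding eventually_sequentially by blast
  have "infinite ((of_nat :: nat \<Rightarrow> rat) ` {N..})"
    using infinite_Ici by (simp add: finite_image_iff inj_on_def)
  moreover have "(of_nat :: nat \<Rightarrow> rat) ` {N..} \<subseteq> {x. poly (p - q) x = 0}"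
    using N by auto
  ultimately have "infinite {x. poly (p - q) x = 0}"
    using finite_subset by blast
  then show ?thesis
    using poly_roots_finite[of "p - q"] by auto
qed

definition hilbert_poly ::
    "(('n::finite, 'm::finite) deriv \<Rightarrow> ('n, 'm) deriv \<Rightarrow> bool) \<Rightarrow>
     ('n, 'm, 'k::zero) lin_dpoly set \<Rightarrow> rat poly"
  where "hilbert_poly prec F = (THE p. eventually_polynomial (hilbert_function prec F) p)"

text \<open>\<open>cone_binom i d \<mu>\<close> is the coefficient \<open>i - d + \<mu> - 1\<close> over \<open>\<mu> - 1\<close>, with the conventions under
  which it is the number of monomials of degree \<open>i\<close> in the cone of a monomial of degree \<open>d\<close> with
  \<open>\<mu>\<close> multiplicative variables.\<close>

definition cone_binom :: "nat \<Rightarrow> nat \<Rightarrow> nat \<Rightarrow> nat"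
  where "cone_binom i d \<mu> =
    (if i < d then 0
     else if \<mu> = 0 then (if i = d then 1 else 0)
     else (i - d + \<mu> - 1) choose (\<mu> - 1))"

text \<open>\<open>binom_poly d \<mu>\<close> is \<open>s - d + \<mu>\<close> over \<open>\<mu>\<close> as a polynomial in \<open>s\<close>; in particular
  \<open>binom_poly 0 n\<close> is \<open>n + s\<close> over \<open>n\<close>.\<close>

definition binom_poly :: "nat \<Rightarrow> nat \<Rightarrow> rat poly"
  where "binom_poly d \<mu> = smult (1 / fact \<mu>) (\<Prod>k=1..\<mu>. [:of_nat k - of_nat d, 1:])"

end

theory Submission
  imports Defs
begin

text \<open>Autoreduction makes the involutive cones of the elements of \<open>U\<^sub>j\<close> pairwise disjoint. They also
  exhaust the principal derivatives: \<open>\<partial>\<^sub>\<alpha> f\<close> has the leading derivative \<open>\<partial>\<^sub>\<alpha> ld(f)\<close>, and if this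
  lay in no cone, an involutive reduction could only add multiples of polynomials with lower leading
  derivatives, so the leading term would survive and the normal form could not be \<open>0\<close>. Hence the
  principal derivatives of order \<open>\<le> s\<close> are counted cone by cone.\<close>

section \<open>Prolongation of leading derivatives\<close>

lemma dprolong_eq_iff:
  "dprolong {#i#} \<theta> = (j, \<alpha>) \<longleftrightarrow> i \<in># \<alpha> \<and> \<theta> = (j, \<alpha> - {#i#})"
  by (cases \<theta>) (auto simp: dprolong_def)

lemma (in differential_field) D_zero: "D i 0 = 0"
  using D_add[of i 0 0] by simp

text \<open>Prolongation by \<open>i\<close> is injective, so each sum over the support collapses to
  at most one term. Off the support the coefficient is 0, and \<open>D_zero\<close> makes the
  formula correct there too.\<close>

lemma (in differential_field) lookup_ldp_diff:
  "Poly_Mapping.lookup (fst (ldp_diff D i p)) (j, \<alpha>) =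
     D i (Poly_Mapping.lookup (fst p) (j, \<alpha>)) +
     (if i \<in># \<alpha> then Poly_Mapping.lookup (fst p) (j, \<alpha> - {#i#}) else 0)"
proof -
  let ?K = "Poly_Mapping.keys (fst p)" and ?c = "Poly_Mapping.lookup (fst p)"
  have "(\<Sum>\<theta>\<in>?K. D i (?c \<theta>) when \<theta> = (j, \<alpha>)) = D i (?c (j, \<alpha>))"
    by (auto simp: when_def in_keys_iff D_zero)
  moreover have "(\<Sum>\<theta>\<in>?K. ?c \<theta> when dprolong {#i#} \<theta> = (j, \<alpha>)) =
      (if i \<in># \<alpha> then ?c (j, \<alpha> - {#i#}) else 0)"
    by (auto simp: dprolong_eq_iff when_def in_keys_iff)
  ultimately show ?thesis
    by (simp add: ldp_diff_def lookup_sum lookup_add lookup_single sum.distrib)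
qed

text \<open>This is what allows \<open>fold_mset\<close> in \<open>ldp_prolong\<close> to be
  unfolded one derivation at a time. The coefficients are compared one by one; for
  \<open>i \<noteq> k\<close> removing one variable does not affect the presence of the
  other.\<close>

lemma (in differential_field) comp_fun_commute_ldp_diff:
  "comp_fun_commute (ldp_diff D :: 'n \<Rightarrow> ('n, 'm, 'k) lin_dpoly \<Rightarrow> _)"
proof
  fix i k :: 'n
  have "ldp_diff D i (ldp_diff D k p) = ldp_diff D k (ldp_diff D i p)"
    for p :: "('n, 'm, 'k) lin_dpoly"
  proof (rule prod_eqI)
    show "fst (ldp_diff D i (ldp_diff D k p)) = fst (ldp_diff D k (ldp_diff D i p))"
    proof (rule poly_mapping_eqI)
      fix \<theta> :: "('n, 'm) deriv"
      obtain j \<alpha> where \<theta>: "\<theta> = (j, \<alpha>)" by (cases \<theta>)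
      have mem: "i \<in># \<alpha> - {#k#} \<longleftrightarrow> i \<in># \<alpha>" "k \<in># \<alpha> - {#i#} \<longleftrightarrow> k \<in># \<alpha>" if "i \<noteq> k"
        using that by (simp_all add: in_diff_count flip: count_greater_zero_iff)
      show "Poly_Mapping.lookup (fst (ldp_diff D i (ldp_diff D k p))) \<theta> =
          Poly_Mapping.lookup (fst (ldp_diff D k (ldp_diff D i p))) \<theta>"
        by (cases "i = k")
          (auto simp: \<theta> lookup_ldp_diff D_add D_zero mem D_commute[of i k]
            add_mset_commute[of i k])
    qed
    show "snd (ldp_diff D i (ldp_diff D k p)) = snd (ldp_diff D k (ldp_diff D i p))"
      by (simp add: ldp_diff_def D_commute)
  qed
  then show "ldp_diff D k \<circ> ldp_diff D i =
      (ldp_diff D i \<circ> ldp_diff D k :: ('n, 'm, 'k) lin_dpoly \<Rightarrow> _)"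
    by (simp add: fun_eq_iff)
qed

text \<open>A relational form of \<open>ld\<close> that includes existence: it fails for a
  polynomial without derivatives, in particular for 0. It can be carried through differentiations
  and reductions without evaluating a definite description.\<close>

definition is_ld ::
    "(('n, 'm) deriv \<Rightarrow> ('n, 'm) deriv \<Rightarrow> bool) \<Rightarrow> ('n, 'm, 'k::zero) lin_dpoly \<Rightarrow>
      ('n, 'm) deriv \<Rightarrow> bool"
  where "is_ld prec p \<theta> \<longleftrightarrow> \<theta> \<in> Poly_Mapping.keys (fst p) \<and>
    (\<forall>\<eta>\<in>Poly_Mapping.keys (fst p). \<eta> \<noteq> \<theta> \<longrightarrow> prec \<eta> \<theta>)"

lemma (in ranking) finite_has_greatest:
  assumes "finite A" "A \<noteq> {}"
  shows "\<exists>\<theta>\<in>A. \<forall>\<eta>\<in>A. \<eta> \<noteq> \<theta> \<longrightarrow> prec \<eta> \<theta>"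
  using assms
proof (induction A rule: finite_ne_induct)
  case (singleton \<theta>)
  then show ?case by simp
next
  case (insert \<eta> A)
  then obtain \<theta> where \<theta>: "\<theta> \<in> A" "\<forall>\<zeta>\<in>A. \<zeta> \<noteq> \<theta> \<longrightarrow> prec \<zeta> \<theta>" by blast
  with insert.hyps have "\<eta> \<noteq> \<theta>" by blast
  then consider "prec \<eta> \<theta>" | "prec \<theta> \<eta>" using prec_total by blast
  then show ?case
  proof cases
    case 1
    with \<theta> show ?thesis by blast
  next
    case 2
    with \<theta> show ?thesis by (metis insert_iff prec_trans)
  qed
qed

lemma (in ranking) is_ld_ld:
  assumes "fst p \<noteq> 0"
  shows "is_ld prec p (ld prec p)"
proof -
  have "Poly_Mapping.keys (fst p) \<noteq> {}" using assms by simp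
  then obtain \<theta> where \<theta>: "is_ld prec p \<theta>"
    using finite_has_greatest[of "Poly_Mapping.keys (fst p)"] by (auto simp: is_ld_def)
  have "is_ld prec p (THE \<theta>. is_ld prec p \<theta>)"
    by (rule theI[of "is_ld prec p", OF \<theta>]) (use \<theta> in \<open>metis is_ld_def prec_irrefl prec_trans\<close>)
  then show ?thesis by (simp add: ld_def is_ld_def)
qed

text \<open>A term of \<open>ldp_diff D i p\<close> comes either from differentiating a coefficient,
  and is then at most \<open>\<theta>\<close>, or from prolonging a derivative of \<open>p\<close>.
  The ranking is preserved by prolongation, so the prolonged \<open>\<theta>\<close> is above all
  others.\<close>

lemma is_ld_ldp_diff:
  assumes "differential_field D" "ranking prec" and p: "is_ld prec p \<theta>"
  shows "is_ld prec (ldp_diff D i p) (dprolong {#i#} \<theta>)"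
proof -
  interpret differential_field D by fact
  interpret ranking prec by fact
  let ?c = "Poly_Mapping.lookup (fst p)"
  have max: "\<eta> = \<theta> \<or> prec \<eta> \<theta>" if "?c \<eta> \<noteq> 0" for \<eta>
    using p that by (auto simp: is_ld_def in_keys_iff)
  have up: "prec \<eta> (dprolong {#i#} \<theta>)" if "?c \<eta> \<noteq> 0" for \<eta>
    using max[OF that] prec_diff prec_trans by blast
  \<comment> \<open>The prolonged \<open>\<theta>\<close> does not occur in \<open>p\<close>, so no
    differentiated coefficient lands on it and its coefficient is exactly that of
    \<open>\<theta>\<close>; no cancellation is possible.\<close>
  have top: "?c (dprolong {#i#} \<theta>) = 0"
    using up prec_irrefl by blast
  obtain j \<alpha> where \<theta>: "\<theta> = (j, \<alpha>)" by (cases \<theta>)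
  have "Poly_Mapping.lookup (fst (ldp_diff D i p)) (dprolong {#i#} \<theta>) = ?c \<theta>"
    using top by (simp add: \<theta> dprolong_def lookup_ldp_diff D_zero)
  moreover have "\<eta> = dprolong {#i#} \<theta> \<or> prec \<eta> (dprolong {#i#} \<theta>)"
    if "\<eta> \<in> Poly_Mapping.keys (fst (ldp_diff D i p))" for \<eta>
  proof -
    obtain k \<beta> where \<eta>: "\<eta> = (k, \<beta>)" by (cases \<eta>)
    from that consider "?c \<eta> \<noteq> 0" | "i \<in># \<beta>" "?c (k, \<beta> - {#i#}) \<noteq> 0"
      by (cases "?c \<eta> = 0") (auto simp: \<eta> in_keys_iff lookup_ldp_diff D_zero split: if_splits)
    then show ?thesis
    proof cases
      case 1
      then show ?thesis using up by blast
    next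
      case 2
      have "\<eta> = dprolong {#i#} (k, \<beta> - {#i#})"
        using 2 by (simp add: \<eta> dprolong_def)
      with max[OF 2(2)] show ?thesis using prec_prolong by auto
    qed
  qed
  ultimately show ?thesis
    using p by (auto simp: is_ld_def in_keys_iff)
qed

lemma is_ld_ldp_prolong:
  assumes "differential_field D" "ranking prec" "is_ld prec p \<theta>"
  shows "is_ld prec (ldp_prolong D \<alpha> p) (dprolong \<alpha> \<theta>)"
proof (induction \<alpha>)
  case empty
  then show ?case using assms by (simp add: ldp_prolong_def dprolong_def)
next
  case (add i \<alpha>)
  have "ldp_prolong D (add_mset i \<alpha>) p = ldp_diff D i (ldp_prolong D \<alpha> p)"
    unfolding ldp_prolong_def
    by (rule comp_fun_commute.fold_mset_add_mset
        [OF differential_field.comp_fun_commute_ldp_diff[OF assms(1)]])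
  moreover have "dprolong (add_mset i \<alpha>) \<theta> = dprolong {#i#} (dprolong \<alpha> \<theta>)"
    by (simp add: dprolong_def)
  ultimately show ?case
    using is_ld_ldp_diff[OF assms(1,2) add.IH] by simp
qed


section \<open>Cones of an involutive set\<close>

lemma lookup_ldp_scale:
  "Poly_Mapping.lookup (fst (ldp_scale c p)) \<theta> = c * Poly_Mapping.lookup (fst p) \<theta>"
  by (simp add: ldp_scale_def map.rep_eq when_def)

text \<open>The cancelled term lies in a cone and \<open>\<theta>\<close> does not, so that term is
  strictly below \<open>\<theta>\<close>. It leads the subtracted polynomial, which therefore leaves
  everything from \<open>\<theta>\<close> upwards unchanged.\<close>

lemma is_ld_inv_reduces:
  assumes "differential_field D" "ranking prec" and F: "\<forall>f\<in>F. fst f \<noteq> 0"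
    and \<theta>: "\<forall>f\<in>F. \<not> mult_prolongation prec L F f \<theta>"
    and p: "is_ld prec p \<theta>" and "inv_reduces D prec L F p q"
  shows "is_ld prec q \<theta>"
proof -
  interpret ranking prec by fact
  from assms(6) obtain f \<beta> c where f: "f \<in> F"
    and a: "Poly_Mapping.lookup (fst p) (dprolong \<beta> (ld prec f)) \<noteq> 0"
    and mult: "mult_prolongation prec L F f (dprolong \<beta> (ld prec f))"
    and q: "q = p - ldp_scale c (ldp_prolong D \<beta> f)"
    by (auto simp: inv_reduces_def Let_def)
  let ?\<eta> = "dprolong \<beta> (ld prec f)" and ?g = "ldp_prolong D \<beta> f"
  have g: "is_ld prec ?g ?\<eta>"
    using is_ld_ldp_prolong[OF assms(1,2) is_ld_ld] F f by blast
  have "prec ?\<eta> \<theta>"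
    using p a mult \<theta> f by (auto simp: is_ld_def in_keys_iff)
  then have below: "prec \<zeta> \<theta>" if "Poly_Mapping.lookup (fst ?g) \<zeta> \<noteq> 0" for \<zeta>
    using g that prec_trans[of \<zeta> ?\<eta> \<theta>]
    by (cases "\<zeta> = ?\<eta>") (auto simp: is_ld_def in_keys_iff)
  have lookup_q: "Poly_Mapping.lookup (fst q) \<zeta> =
      Poly_Mapping.lookup (fst p) \<zeta> - c * Poly_Mapping.lookup (fst ?g) \<zeta>" for \<zeta>
    by (simp add: q lookup_minus lookup_ldp_scale)
  have "Poly_Mapping.lookup (fst ?g) \<theta> = 0"
    using below prec_irrefl by blast
  then show ?thesis
    using p below by (auto simp: is_ld_def in_keys_iff lookup_q)
qed

lemma prolongation_in_cone:
  assumes "differential_field D" "ranking prec" and F: "\<forall>f\<in>F. fst f \<noteq> 0"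
    and inv: "inv_set D prec L F" and f: "f \<in> F"
  shows "\<exists>g\<in>F. mult_prolongation prec L F g (dprolong \<alpha> (ld prec f))"
proof (rule ccontr)
  let ?\<theta> = "dprolong \<alpha> (ld prec f)"
  assume none: "\<not> ?thesis"
  have survives: "is_ld prec q ?\<theta>"
    if "(inv_reduces D prec L F)\<^sup>*\<^sup>* (ldp_prolong D \<alpha> f) q" for q
    using that
  proof (induction rule: rtranclp_induct)
    case base
    have "is_ld prec f (ld prec f)"
      using ranking.is_ld_ld[OF assms(2)] bspec[OF F f] .
    then show ?case by (rule is_ld_ldp_prolong[OF assms(1,2)])
  next
    case (step q r)
    have "\<forall>g\<in>F. \<not> mult_prolongation prec L F g ?\<theta>"
      using none by simp
    from is_ld_inv_reduces[OF assms(1,2) F this step.IH step.hyps(2)] show ?case .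
  qed
  have "(inv_reduces D prec L F)\<^sup>*\<^sup>* (ldp_prolong D \<alpha> f) 0"
    using inv f by (auto simp: inv_set_def inv_normal_forms_def)
  \<comment> \<open>The polynomial 0 has empty support and hence no leading derivative.\<close>
  from survives[OF this] show False by (simp add: is_ld_def)
qed

text \<open>One inclusion is involutivity; the other holds because a cone consists of multiples of
  its vertex. The dependent sum over \<open>j\<close> later lets the count split into one count per
  indeterminate.\<close>

lemma principal_derivs_eq_cones:
  assumes "differential_field D" "ranking prec" "\<forall>f\<in>F. fst f \<noteq> 0" "inv_set D prec L F"
  shows "principal_derivs prec F =
    (SIGMA j:UNIV. \<Union>u\<in>ld_monoms prec F j. inv_cone L u (ld_monoms prec F j))"
    (is "_ = ?R")
proof
  show "principal_derivs prec F \<subseteq> ?R"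
  proof
    fix \<theta> assume "\<theta> \<in> principal_derivs prec F"
    then obtain g where g: "g \<in> F" "mult_prolongation prec L F g \<theta>"
      using prolongation_in_cone[OF assms] unfolding principal_derivs_def by blast
    moreover have "snd (ld prec g) \<in> ld_monoms prec F (fst (ld prec g))"
      using g by (auto simp: ld_monoms_def intro: rev_image_eqI)
    ultimately show "\<theta> \<in> ?R"
      by (cases \<theta>) (auto simp: mult_prolongation_def)
  qed
  show "?R \<subseteq> principal_derivs prec F"
  proof
    fix \<theta> assume "\<theta> \<in> ?R"
    then obtain u w where uw: "(fst \<theta>, u) \<in> ld prec ` F" "snd \<theta> = u + w"
      by (cases \<theta>) (auto simp: inv_cone_def ld_monoms_def)
    then have "\<theta> = dprolong w (fst \<theta>, u)"
      by (simp add: prod_eq_iff dprolong_def add.commute)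
    with uw(1) show "\<theta> \<in> principal_derivs prec F"
      unfolding principal_derivs_def by blast
  qed
qed

lemma finite_ld_monoms:
  assumes "finite F"
  shows "finite (ld_monoms prec F j)"
proof -
  have "\<alpha> \<in> snd ` ld prec ` F" if "\<alpha> \<in> ld_monoms prec F j" for \<alpha>
    using imageI[of "(j, \<alpha>)" "ld prec ` F" snd] that by (simp add: ld_monoms_def)
  then have "ld_monoms prec F j \<subseteq> snd ` ld prec ` F" by blast
  then show ?thesis by (rule finite_subset) (use assms in simp)
qed

text \<open>If two cones meet, one vertex lies in the other cone by \<open>L_disjoint\<close>. That
  vertex is a term of the polynomial it leads, which is then reducible modulo the other one, against
  autoreduction.\<close>

lemma disjoint_cones:
  assumes "ranking prec" "involutive_division L" "finite F" and F: "\<forall>f\<in>F. fst f \<noteq> 0"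
    and red: "inv_autoreduced prec L F"
    and uv: "u \<in> ld_monoms prec F j" "v \<in> ld_monoms prec F j" "u \<noteq> v"
  shows "inv_cone L u (ld_monoms prec F j) \<inter> inv_cone L v (ld_monoms prec F j) = {}"
proof -
  interpret ranking prec by fact
  interpret involutive_division L by fact
  have outside: "x \<notin> inv_cone L y (ld_monoms prec F j)"
    if xy: "x \<in> ld_monoms prec F j" "y \<in> ld_monoms prec F j" "x \<noteq> y" for x y
  proof
    assume cone: "x \<in> inv_cone L y (ld_monoms prec F j)"
    have "(j, x) \<in> ld prec ` F" "(j, y) \<in> ld prec ` F"
      using xy by (simp_all add: ld_monoms_def)
    then obtain f g where f: "f \<in> F" "(j, x) = ld prec f" and g: "g \<in> F" "(j, y) = ld prec g"
      by (elim imageE)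
    have "(j, x) \<in> Poly_Mapping.keys (fst f)"
      using is_ld_ld[OF bspec[OF F f(1)]] unfolding f(2) is_ld_def by (rule conjunct1)
    then have "inv_reducible prec L F f g"
      unfolding inv_reducible_def mult_prolongation_def g(2)[symmetric]
      by (rule bexI[rotated]) (use cone in simp)
    moreover have "g \<noteq> f" using f(2) g(2) xy(3) by (metis prod.inject)
    ultimately show False using red f(1) g(1) unfolding inv_autoreduced_def by blast
  qed
  show ?thesis
    using L_disjoint[OF finite_ld_monoms[OF \<open>finite F\<close>] uv(1,2)] outside uv by blast
qed


section \<open>Counting monomials in cones\<close>

text \<open>Stars and bars, with the lower index of the binomial reflected. The convention for
  \<open>\<mu> = 0\<close> matches the empty alphabet, over which only the empty multiset
  exists.\<close>

lemma card_multisets_of_size_eq_cone_binom: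
  assumes "finite A"
  shows "card (multisets_of_size A i) = cone_binom i 0 (card A)"
proof (cases "card A")
  case 0
  then show ?thesis using assms by (auto simp: cone_binom_def)
next
  case (Suc \<mu>)
  then show ?thesis
    using assms binomial_symmetric[of i "\<mu> + i"]
    by (simp add: card_multisets_of_size cone_binom_def add.commute)
qed

text \<open>The hockey-stick identity: each step of the induction from \<open>d\<close> on is
  Pascal's rule.\<close>

lemma sum_cone_binom:
  "(\<Sum>i\<le>s. cone_binom i d \<mu>) = (if s < d then 0 else (s - d + \<mu>) choose \<mu>)"
proof (induction s)
  case 0
  then show ?case by (auto simp: cone_binom_def)
next
  case (Suc s)
  consider "Suc s < d" | "Suc s = d" | "d \<le> s" by linarith
  then show ?case
  proof cases
    case 3
    then show ?thesis
      using Suc by (cases \<mu>) (auto simp: cone_binom_def Suc_diff_le)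
  qed (use Suc in \<open>auto simp: cone_binom_def\<close>)
qed

text \<open>A submonoid closed under divisors is generated by the variables it contains. Hence the
  shape of a cone depends only on its multiplicative variables.\<close>

lemma (in involutive_division) division_eq_multiplicative:
  assumes "finite U" "u \<in> U"
  shows "L u U = {w. set_mset w \<subseteq> {i. {#i#} \<in> L u U}}"
proof (intro equalityI subsetI)
  fix w assume "w \<in> L u U"
  then show "w \<in> {w. set_mset w \<subseteq> {i. {#i#} \<in> L u U}}"
    using L_dvd[OF assms] by auto
next
  fix w assume "w \<in> {w. set_mset w \<subseteq> {i. {#i#} \<in> L u U}}"
  then show "w \<in> L u U"
  proof (induction w)
    case empty
    show ?case using L_one[OF assms] .
  next
    case (add i w)
    then show ?case using L_mult[OF assms, of "{#i#}" w] by simp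
  qed
qed

lemma (in involutive_division) card_cone:
  assumes "finite U" "u \<in> U"
  shows "card {v \<in> inv_cone L u U. size v = i} = cone_binom i (size u) (num_mult_vars L u U)"
proof (cases "i < size u")
  case True
  then have "{v \<in> inv_cone L u U. size v = i} = {}" by (auto simp: inv_cone_def)
  with True show ?thesis by (simp add: cone_binom_def del: Collect_empty_eq)
next
  \<comment> \<open>Only here is \<open>i - size u\<close> a true difference: translation by
    \<open>u\<close> matches the slice of degree \<open>i\<close> with the multisets of that size
    over the multiplicative variables.\<close>
  case False
  define M where "M = {k. {#k#} \<in> L u U}"
  have L: "L u U = {w. set_mset w \<subseteq> M}"
    unfolding M_def by (rule division_eq_multiplicative[OF assms])
  have "{v \<in> inv_cone L u U. size v = i} = (+) u ` multisets_of_size M (i - size u)"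
    using False by (auto simp: inv_cone_def multisets_of_size_def L)
  then have "card {v \<in> inv_cone L u U. size v = i} = cone_binom (i - size u) 0 (card M)"
    by (simp add: card_image card_multisets_of_size_eq_cone_binom)
  with False show ?thesis by (auto simp: cone_binom_def num_mult_vars_def M_def)
qed

text \<open>The set of all monomials is treated as the cone with vertex 1 in which every variable is
  multiplicative, so the same two counting lemmas apply.\<close>

lemma finite_multisets_size_le: "finite {v :: 'a::finite multiset. size v \<le> s}"
  and card_multisets_size_le:
    "card {v :: 'a::finite multiset. size v \<le> s} = (CARD('a) + s) choose s"
proof -
  have eq: "{v :: 'a multiset. size v \<le> s} = (\<Union>i\<le>s. multisets_of_size UNIV i)"
    by (auto simp: multisets_of_size_def)
  have fin: "finite (multisets_of_size (UNIV :: 'a set) i)" for i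
    by (rule finite_multisets_of_size) simp
  show "finite {v :: 'a multiset. size v \<le> s}"
    unfolding eq using fin by blast
  have "card {v :: 'a multiset. size v \<le> s} = (\<Sum>i\<le>s. card (multisets_of_size (UNIV :: 'a set) i))"
    unfolding eq by (rule card_UN_disjoint) (use fin in \<open>auto simp: multisets_of_size_def\<close>)
  also have "\<dots> = (s + CARD('a)) choose CARD('a)"
    by (simp add: card_multisets_of_size_eq_cone_binom sum_cone_binom)
  also have "\<dots> = (CARD('a) + s) choose s"
    using binomial_symmetric[of "CARD('a)" "CARD('a) + s"] by (simp add: add.commute)
  finally show "card {v :: 'a multiset. size v \<le> s} = (CARD('a) + s) choose s" .
qed

lemma (in involutive_division) card_UN_cones:
  assumes "finite U"
    and "\<And>u v. u \<in> U \<Longrightarrow> v \<in> U \<Longrightarrow> u \<noteq> v \<Longrightarrow> inv_cone L u U \<inter> inv_cone L v U = {}"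
  shows "card {v \<in> (\<Union>u\<in>U. inv_cone L u U). size v \<le> s} =
    (\<Sum>i\<le>s. \<Sum>u\<in>U. cone_binom i (size u) (num_mult_vars L u U))"
proof -
  let ?C = "\<lambda>u i. {v \<in> inv_cone L u U. size v = i}"
  have fin: "finite (?C u i)" for u i
    by (rule finite_subset[OF _ finite_multisets_size_le[of i]]) auto
  \<comment> \<open>Cones may be infinite, so they are first cut into finite slices of fixed degree;
    the slices are disjoint both across degrees and across vertices.\<close>
  have "{v \<in> (\<Union>u\<in>U. inv_cone L u U). size v \<le> s} = (\<Union>i\<le>s. \<Union>u\<in>U. ?C u i)"
    by auto
  also have "card \<dots> = (\<Sum>i\<le>s. card (\<Union>u\<in>U. ?C u i))"
    by (rule card_UN_disjoint) (use fin assms(1) in auto)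
  also have "\<dots> = (\<Sum>i\<le>s. \<Sum>u\<in>U. card (?C u i))"
    by (intro sum.cong refl card_UN_disjoint) (use fin assms in blast)+
  finally show ?thesis using assms(1) by (simp add: card_cone)
qed

lemma poly_binom_poly:
  assumes "d \<le> s"
  shows "poly (binom_poly d \<mu>) (of_nat s) = of_nat ((s - d + \<mu>) choose \<mu>)"
proof -
  have "(of_nat ((s - d + \<mu>) choose \<mu>) :: rat) =
      pochhammer (of_nat (s - d + \<mu>) - of_nat \<mu> + 1) \<mu> / fact \<mu>"
    by (simp add: binomial_gbinomial gbinomial_pochhammer')
  \<comment> \<open>The two occurrences of \<open>\<mu>\<close> cancel, so the rising factorial
    starts at \<open>s - d + 1\<close>. The bound \<open>d \<le> s\<close> turns the truncated
    difference into a rational one.\<close>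
  also have "pochhammer (of_nat (s - d + \<mu>) - of_nat \<mu> + 1) \<mu> =
      (\<Prod>k<\<mu>. (of_nat s - of_nat d + of_nat (Suc k) :: rat))"
    using assms by (simp add: pochhammer_prod of_nat_diff add_ac atLeast0LessThan)
  also have "\<dots> = (\<Prod>k=1..\<mu>. of_nat s - of_nat d + of_nat k)"
    by (rule prod.reindex_bij_witness[of _ "\<lambda>k. k - 1" Suc]) auto
  finally show ?thesis
    by (simp add: binom_poly_def poly_prod algebra_simps)
qed


section \<open>The Hilbert function and the Hilbert polynomial\<close>

theorem mainTheorem2:
  fixes D :: "'n::finite \<Rightarrow> 'k::field_char_0 \<Rightarrow> 'k"
    and prec :: "('n, 'm::finite) deriv \<Rightarrow> ('n, 'm) deriv \<Rightarrow> bool"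
    and L :: "'n monom \<Rightarrow> 'n monom set \<Rightarrow> 'n monom set"
    and F :: "('n, 'm, 'k) lin_dpoly set"
  assumes "differential_field D"
    and "orderly_ranking prec"
    and "involutive_division L"
    and "finite F"
    and "\<forall>f\<in>F. fst f \<noteq> 0"
    and "inv_set D prec L F"
  shows "(\<forall>s. int (hilbert_function prec F s) =
            int (CARD('m) * ((CARD('n) + s) choose s))
            - (\<Sum>j\<in>(UNIV :: 'm set). \<Sum>i\<le>s. \<Sum>u\<in>ld_monoms prec F j.
                 int (cone_binom i (size u) (num_mult_vars L u (ld_monoms prec F j)))))
       \<and> eventually_polynomial (hilbert_function prec F) (hilbert_poly prec F)
       \<and> hilbert_poly prec F =
            of_nat CARD('m) * binom_poly 0 CARD('n)
            - (\<Sum>j\<in>(UNIV :: 'm set). \<Sum>u\<in>ld_monoms prec F j.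
                 binom_poly (size u) (num_mult_vars L u (ld_monoms prec F j)))"
proof -
  interpret orderly_ranking prec by fact
  interpret involutive_division L by fact
  have rank: "ranking prec" by unfold_locales
  let ?U = "ld_monoms prec F"
  let ?\<mu> = "\<lambda>u j. num_mult_vars L u (?U j)"
  let ?N = "\<lambda>s. \<Sum>j\<in>(UNIV :: 'm set). \<Sum>i\<le>s. \<Sum>u\<in>?U j. cone_binom i (size u) (?\<mu> u j)"
  let ?A = "\<lambda>s. {\<theta> :: ('n, 'm) deriv. dorder \<theta> \<le> s}"
  let ?p = "of_nat CARD('m) * binom_poly 0 CARD('n)
            - (\<Sum>j\<in>(UNIV :: 'm set). \<Sum>u\<in>?U j. binom_poly (size u) (?\<mu> u j))"
  have finU: "finite (?U j)" for j
    using finite_ld_monoms[OF \<open>finite F\<close>] .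
  have A: "?A s = UNIV \<times> {v. size v \<le> s}" for s
    by (auto simp: dorder_def)
  have finA: "finite (?A s)" for s
    unfolding A using finite_multisets_size_le by (intro finite_cartesian_product) auto
  have cardA: "card (?A s) = CARD('m) * ((CARD('n) + s) choose s)" for s
    unfolding A by (simp add: card_cartesian_product card_multisets_size_le)
  have principal: "card (principal_derivs prec F \<inter> ?A s) = ?N s" for s
  proof -
    have disj: "inv_cone L u (?U j) \<inter> inv_cone L v (?U j) = {}"
      if "u \<in> ?U j" "v \<in> ?U j" "u \<noteq> v" for u v j
      using disjoint_cones[OF rank assms(3,4,5) _ that] assms(6) by (simp add: inv_set_def)
    have "principal_derivs prec F \<inter> ?A s =
        (SIGMA j:UNIV. {v \<in> (\<Union>u\<in>?U j. inv_cone L u (?U j)). size v \<le> s})"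
      unfolding principal_derivs_eq_cones[OF assms(1) rank assms(5,6)] A by auto
    also have "card \<dots> = (\<Sum>j\<in>UNIV. card {v \<in> (\<Union>u\<in>?U j. inv_cone L u (?U j)). size v \<le> s})"
      by (rule card_SigmaI)
        (auto intro: finite_subset[OF _ finite_multisets_size_le[of s]])
    also have "\<dots> = ?N s"
      by (intro sum.cong refl card_UN_cones finU disj)
    finally show ?thesis .
  qed
  \<comment> \<open>Parametric plus principal derivatives give all derivatives of order at most
    \<open>s\<close>. The additive form avoids truncated subtraction on the naturals.\<close>
  have hf: "hilbert_function prec F s + ?N s = CARD('m) * ((CARD('n) + s) choose s)" for s
  proof -
    have "{\<theta>. \<theta> \<notin> principal_derivs prec F \<and> dorder \<theta> \<le> s} =
        ?A s - principal_derivs prec F \<inter> ?A s" by auto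
    then have "hilbert_function prec F s = card (?A s) - card (principal_derivs prec F \<inter> ?A s)"
      using finA by (simp add: hilbert_function_def card_Diff_subset)
    moreover have "card (principal_derivs prec F \<inter> ?A s) \<le> card (?A s)"
      by (rule card_mono[OF finA]) auto
    ultimately show ?thesis by (simp add: principal cardA)
  qed
  have ev: "eventually_polynomial (hilbert_function prec F) ?p"
    unfolding eventually_polynomial_def
  proof -
    \<comment> \<open>From the largest vertex degree on, every cone has reached its vertex and its
      count is given by the polynomial. The inserted 0 keeps \<open>Max\<close> meaningful when all
      \<open>?U j\<close> are empty.\<close>
    define d where "d = Max (insert 0 (size ` (\<Union>j. ?U j)))"
    have d: "size u \<le> d" if "u \<in> ?U j" for u j
      unfolding d_def by (rule Max_ge) (use finU that in auto)
    have "poly ?p (of_nat s) = of_nat (hilbert_function prec F s)" if "d \<le> s" for s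
    proof -
      \<comment> \<open>Moving the sum over degrees inside makes it the hockey-stick sum of a single
        cone.\<close>
      have "?N s = (\<Sum>j\<in>UNIV. \<Sum>u\<in>?U j. \<Sum>i\<le>s. cone_binom i (size u) (?\<mu> u j))"
        by (intro sum.cong refl sum.swap)
      also have "\<dots> = (\<Sum>j\<in>UNIV. \<Sum>u\<in>?U j. (s - size u + ?\<mu> u j) choose ?\<mu> u j)"
        by (intro sum.cong refl) (use d that in \<open>force simp: sum_cone_binom\<close>)
      finally have "rat_of_nat (?N s) =
          (\<Sum>j\<in>UNIV. \<Sum>u\<in>?U j. poly (binom_poly (size u) (?\<mu> u j)) (of_nat s))"
        by (simp only: of_nat_sum) (intro sum.cong refl poly_binom_poly[symmetric],
          use d that in \<open>force intro: le_trans\<close>)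
      moreover have "poly (binom_poly 0 CARD('n)) (of_nat s) =
          rat_of_nat ((CARD('n) + s) choose s)"
        using poly_binom_poly[of 0 s "CARD('n)"] binomial_symmetric[of s "CARD('n) + s"]
        by (simp add: add.commute)
      ultimately have "poly ?p (of_nat s) =
          rat_of_nat (CARD('m) * ((CARD('n) + s) choose s)) - rat_of_nat (?N s)"
        by (simp add: poly_sum del: of_nat_sum)
      also have "\<dots> = of_nat (hilbert_function prec F s)"
        by (simp only: hf[symmetric] of_nat_add)
      finally show ?thesis .
    qed
    then show "\<forall>\<^sub>F s in sequentially. poly ?p (of_nat s) = of_nat (hilbert_function prec F s)"
      unfolding eventually_sequentially by blast
  qed
  \<comment> \<open>The definite description is resolved by \<open>ev\<close> for existence and by
    the finiteness of the roots of a nonzero polynomial, through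
    \<open>eventually_polynomial_unique\<close>, for uniqueness.\<close>
  have hp: "hilbert_poly prec F = ?p"
    unfolding hilbert_poly_def by (rule the_equality)
      (use ev eventually_polynomial_unique in blast)+
  have "int (hilbert_function prec F s) =
      int (CARD('m) * ((CARD('n) + s) choose s)) - int (?N s)" for s
    using hf[of s] by linarith
  then show ?thesis
    using ev hp by simp
qed

end
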